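(* Let $p\in(0,1)$ be fixed and let $G$ and $H$ be two independent Erdős–Rényi graphs $G(n,p)$. Let $I(G\times H)$ denote the number of isolated vertices of $G\times H$. Then $$\frac{\mathbb{E}[I(G\times H)]}{2n^2(1-p)^{n-1}}\to 1\quad\text{as } n\to\infty.$$
   Context: An Erdős–Rényi graph $G(n,p)$ is a random simple graph on $\{1,\dots,n\}$ with each edge present independently with probability $p$. The tensor product $G\times H$ has vertex set $V(G)\times V(H)$, with $(v_1,v_2)$ adjacent to $(v_1',v_2')$ iff $v_1v_1'\in E(G)$ and $v_2v_2'\in E(H)$. A vertex is isolated if it has degree $0$. *)

theory Defs
  imports "HOL-Probability.Probability"
begin

record 'a graph =
  verts :: "'a set"
  edges :: "'a set set"

definition potential_edges :: "'a set \<Rightarrow> 'a set set" where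
  "potential_edges V = {e. e \<subseteq> V \<and> card e = 2}"

definition simple_graph :: "'a graph \<Rightarrow> bool" where
  "simple_graph G \<longleftrightarrow> finite (verts G) \<and> edges G \<subseteq> potential_edges (verts G)"

definition adjacent :: "'a graph \<Rightarrow> 'a \<Rightarrow> 'a \<Rightarrow> bool" where
  "adjacent G u v \<longleftrightarrow> {u, v} \<in> edges G"

definition degree :: "'a graph \<Rightarrow> 'a \<Rightarrow> nat" where
  "degree G v = card {w \<in> verts G. adjacent G v w}"

definition isolated_vertices :: "'a graph \<Rightarrow> 'a set" where
  "isolated_vertices G = {v \<in> verts G. degree G v = 0}"

definition num_isolated :: "'a graph \<Rightarrow> nat" where
  "num_isolated G = card (isolated_vertices G)"

definition tensor_product :: "'a graph \<Rightarrow> 'b graph \<Rightarrow> ('a \<times> 'b) graph" where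
  "tensor_product G H =
     \<lparr>verts = verts G \<times> verts H,
      edges = {{(v1, v2), (v1', v2')} | v1 v2 v1' v2'. adjacent G v1 v1' \<and> adjacent H v2 v2'}\<rparr>"

text \<open>
  The potential edges carry independent Bernoulli variables, and a potential edge is present
  iff its variable is true.  The argument \<^term>\<open>False\<close> of \<^const>\<open>Pi_pmf\<close> is only the default
  value outside the index set.  \<^const>\<open>bernoulli_pmf\<close> is meaningful for
  \<^term>\<open>0 \<le> p \<and> p \<le> (1::real)\<close>.
\<close>
definition erdos_renyi :: "nat \<Rightarrow> real \<Rightarrow> nat graph pmf" where
  "erdos_renyi n p =
     map_pmf (\<lambda>X. \<lparr>verts = {1..n}, edges = {e \<in> potential_edges {1..n}. X e}\<rparr>)
       (Pi_pmf (potential_edges {1..n}) False (\<lambda>_. bernoulli_pmf p))"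

lemma simple_graph_erdos_renyi:
  assumes "G \<in> set_pmf (erdos_renyi n p)"
  shows "simple_graph G" and "verts G = {1..n}"
  using assms by (auto simp: erdos_renyi_def simple_graph_def)

lemma adjacent_tensor_product:
  "adjacent (tensor_product G H) (v1, v2) (v1', v2') \<longleftrightarrow> adjacent G v1 v1' \<and> adjacent H v2 v2'"
  by (auto simp: adjacent_def tensor_product_def doubleton_eq_iff insert_commute)

lemma simple_graph_tensor_product:
  assumes "simple_graph G" and "simple_graph H"
  shows "simple_graph (tensor_product G H)"
proof -
  have "e \<in> potential_edges (verts G \<times> verts H)" if e: "e \<in> edges (tensor_product G H)" for e
  proof -
    obtain v1 v2 v1' v2' where *: "e = {(v1, v2), (v1', v2')}"
      "adjacent G v1 v1'" "adjacent H v2 v2'"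
      using e by (auto simp: tensor_product_def)
    have "{v1, v1'} \<in> potential_edges (verts G)" "{v2, v2'} \<in> potential_edges (verts H)"
      using * assms by (auto simp: adjacent_def simple_graph_def)
    then show ?thesis
      using * by (auto simp: potential_edges_def card_2_iff doubleton_eq_iff)
  qed
  then have "edges (tensor_product G H) \<subseteq> potential_edges (verts G \<times> verts H)"
    by blast
  moreover have "verts (tensor_product G H) = verts G \<times> verts H"
    by (simp add: tensor_product_def)
  ultimately show ?thesis
    using assms by (simp add: simple_graph_def)
qed

end

(* A vertex (v, w) of G x H is isolated iff v is isolated in G or w is isolated in H.  By
   inclusion-exclusion the number of isolated vertices is n (I G + I H) - I G * I H, and since G and
   H are independent with E (I G) = n (1 - p)^(n-1), the ratio in question is exactly
   1 - (1 - p)^(n-1) / 2 for n > 0. *)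
theory Submission
  imports Defs
begin

lemma degree_eq_0_iff:
  assumes "finite (verts G)"
  shows "degree G v = 0 \<longleftrightarrow> (\<forall>w \<in> verts G. \<not> adjacent G v w)"
  using assms by (auto simp: degree_def)

text \<open>The neighbourhood of \<open>(v, w)\<close> is the product of the neighbourhoods of
  \<open>v\<close> and \<open>w\<close>, and a product of sets is empty iff one of the factors
  is.\<close>

lemma isolated_vertices_tensor_product:
  assumes "finite (verts G)" and "finite (verts H)"
  shows "isolated_vertices (tensor_product G H) =
           isolated_vertices G \<times> verts H \<union> verts G \<times> isolated_vertices H"
proof -
  have verts: "verts (tensor_product G H) = verts G \<times> verts H"
    by (simp add: tensor_product_def)
  have "finite (verts (tensor_product G H))"
    using assms by (simp add: verts)
  then show ?thesis
    using assms
    by (auto simp: isolated_vertices_def degree_eq_0_iff verts adjacent_tensor_product)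
qed

lemma num_isolated_tensor_product:
  assumes "finite (verts G)" and "finite (verts H)"
  shows "real (num_isolated (tensor_product G H)) =
           real (card (verts H)) * real (num_isolated G) + real (card (verts G)) * real (num_isolated H)
           - real (num_isolated G) * real (num_isolated H)"
proof -
  let ?I = "isolated_vertices G" and ?J = "isolated_vertices H"
  have sub: "?I \<subseteq> verts G" "?J \<subseteq> verts H"
    by (auto simp: isolated_vertices_def)
  then have fin: "finite ?I" "finite ?J"
    using assms by (auto intro: finite_subset)
  have "(?I \<times> verts H) \<inter> (verts G \<times> ?J) = ?I \<times> ?J"
    using sub by auto
  then have "card (?I \<times> verts H) + card (verts G \<times> ?J) =
      card (isolated_vertices (tensor_product G H)) + card (?I \<times> ?J)"
    using card_Un_Int[of "?I \<times> verts H" "verts G \<times> ?J"] assms fin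
    by (simp add: isolated_vertices_tensor_product)
  \<comment> \<open>The additive form of inclusion-exclusion is cast to the reals before anything is
    subtracted, which avoids truncated subtraction on \<open>nat\<close>.\<close>
  then have "real (card ?I * card (verts H) + card (verts G) * card ?J) =
      real (card (isolated_vertices (tensor_product G H)) + card ?I * card ?J)"
    by (simp add: card_cartesian_product)
  then show ?thesis
    by (simp add: num_isolated_def algebra_simps)
qed

lemma finite_potential_edges: "finite V \<Longrightarrow> finite (potential_edges V)"
  by (rule finite_subset[of _ "Pow V"]) (auto simp: potential_edges_def)

text \<open>With finite support, every real function is integrable and expectations are finite
  sums.\<close>

lemma finite_set_pmf_erdos_renyi: "finite (set_pmf (erdos_renyi n p))"
proof (rule finite_subset)
  show "set_pmf (erdos_renyi n p) \<subseteq>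
      (\<lambda>E. \<lparr>verts = {1..n}, edges = E\<rparr>) ` Pow (potential_edges {1..n})"
    by (auto simp: erdos_renyi_def)
qed (simp add: finite_potential_edges)

text \<open>This is where independence enters: the weights of \<open>pair_pmf\<close> are products,
  so the finite double sum factorises.\<close>

lemma expectation_pair_pmf_mult:
  fixes f :: "'a \<Rightarrow> real" and g :: "'b \<Rightarrow> real"
  assumes "finite (set_pmf p)" and "finite (set_pmf q)"
  shows "measure_pmf.expectation (pair_pmf p q) (\<lambda>x. f (fst x) * g (snd x)) =
           measure_pmf.expectation p f * measure_pmf.expectation q g"
proof -
  have "measure_pmf.expectation (pair_pmf p q) (\<lambda>x. f (fst x) * g (snd x)) =
      (\<Sum>(a, b) \<in> set_pmf p \<times> set_pmf q. (f a * pmf p a) * (g b * pmf q b))"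
    using assms
    by (subst integral_measure_pmf_real[of "set_pmf p \<times> set_pmf q"])
       (auto simp: pmf_pair intro!: sum.cong)
  also have "\<dots> = (\<Sum>a\<in>set_pmf p. f a * pmf p a) * (\<Sum>b\<in>set_pmf q. g b * pmf q b)"
    by (simp add: sum_product sum.cartesian_product)
  also have "\<dots> = measure_pmf.expectation p f * measure_pmf.expectation q g"
    using assms by (simp add: integral_measure_pmf_real[where A = "set_pmf p"]
        integral_measure_pmf_real[where A = "set_pmf q"])
  finally show ?thesis .
qed

text \<open>A potential edge at \<open>v\<close> is determined by its other endpoint, which ranges
  over \<open>V - {v}\<close>. This is the source of the exponent \<open>n - 1\<close>.\<close>

lemma card_potential_edges_incident:
  assumes "finite V" and "v \<in> V"
  shows "card {e \<in> potential_edges V. v \<in> e} = card V - 1"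
proof -
  have "{e \<in> potential_edges V. v \<in> e} = (\<lambda>w. {v, w}) ` (V - {v})"
    using assms by (auto simp: potential_edges_def card_2_iff insert_commute)
  moreover have "inj_on (\<lambda>w. {v, w}) (V - {v})"
    by (auto simp: inj_on_def doubleton_eq_iff)
  ultimately show ?thesis
    using assms by (simp add: card_image)
qed

text \<open>Restates isolation as a condition on each edge separately, so that it becomes a product
  event in the edge variables. In a simple graph an edge containing \<open>v\<close> has its second
  endpoint among the vertices, so it yields a neighbour.\<close>

lemma isolated_vertices_iff_no_incident_edge:
  assumes "simple_graph G"
  shows "v \<in> isolated_vertices G \<longleftrightarrow> v \<in> verts G \<and> (\<forall>e \<in> edges G. v \<notin> e)"
proof -
  have "\<exists>w \<in> verts G. {v, w} \<in> edges G" if "e \<in> edges G" "v \<in> e" for e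
  proof -
    have "e \<subseteq> verts G" "card e = 2"
      using assms that by (auto simp: simple_graph_def potential_edges_def)
    with that show ?thesis
      by (auto simp: card_2_iff insert_commute)
  qed
  then show ?thesis
    using assms
    by (auto simp: isolated_vertices_def degree_eq_0_iff simple_graph_def adjacent_def)
qed

lemma prob_isolated_erdos_renyi:
  assumes "0 \<le> p" and "p \<le> 1" and "v \<in> {1..n}"
  shows "measure_pmf.prob (erdos_renyi n p) {G. v \<in> isolated_vertices G} = (1 - p) ^ (n - 1)"
proof -
  let ?A = "potential_edges {1..n}"
  \<comment> \<open>The values allowed to the variable of \<open>e\<close> if \<open>v\<close> is to
    be isolated: edges at \<open>v\<close> must be absent, all others are free.
    \<open>Pi ?A ?B\<close> leaves the coordinates outside \<open>?A\<close> unrestricted, so the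
    default value of \<open>Pi_pmf\<close> does not affect membership.\<close>
  let ?B = "\<lambda>e. if v \<in> e then {False} else UNIV"
  have fin: "finite ?A"
    by (simp add: finite_potential_edges)
  have "(\<lambda>X. \<lparr>verts = {1..n}, edges = {e \<in> ?A. X e}\<rparr>) -` {G. v \<in> isolated_vertices G} = Pi ?A ?B"
    using assms(3)
    by (auto simp: isolated_vertices_iff_no_incident_edge simple_graph_def split: if_splits)
  then have "measure_pmf.prob (erdos_renyi n p) {G. v \<in> isolated_vertices G} =
      measure_pmf.prob (Pi_pmf ?A False (\<lambda>_. bernoulli_pmf p)) (Pi ?A ?B)"
    by (simp add: erdos_renyi_def)
  also have "\<dots> = (\<Prod>e\<in>?A. measure_pmf.prob (bernoulli_pmf p) (?B e))"
    by (rule measure_Pi_pmf_Pi[OF fin])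
  also have "\<dots> = (\<Prod>e\<in>?A. if v \<in> e then 1 - p else 1)"
    using assms by (intro prod.cong) (auto simp: measure_pmf_single)
  also have "\<dots> = (1 - p) ^ card {e \<in> ?A. v \<in> e}"
    using fin by (simp add: prod.inter_filter[symmetric])
  also have "card {e \<in> ?A. v \<in> e} = n - 1"
    using assms(3) by (subst card_potential_edges_incident) auto
  finally show ?thesis .
qed

lemma expectation_num_isolated_erdos_renyi:
  assumes "0 \<le> p" and "p \<le> 1"
  shows "measure_pmf.expectation (erdos_renyi n p) (\<lambda>G. real (num_isolated G)) =
           real n * (1 - p) ^ (n - 1)"
proof -
  let ?M = "erdos_renyi n p"
  \<comment> \<open>Linearity of expectation over vertex indicators. The identity is shown on the
    support only, where the vertex set is \<open>{1..n}\<close>; that suffices for almost-everywhere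
    equality.\<close>
  have "real (num_isolated G) = (\<Sum>v\<in>{1..n}. indicator {G. v \<in> isolated_vertices G} G)"
    if "G \<in> set_pmf ?M" for G
  proof -
    have "isolated_vertices G = {v \<in> {1..n}. v \<in> isolated_vertices G}"
      using simple_graph_erdos_renyi(2)[OF that] by (auto simp: isolated_vertices_def)
    then have "num_isolated G = card {v \<in> {1..n}. v \<in> isolated_vertices G}"
      by (simp add: num_isolated_def)
    then show ?thesis
      by (simp add: indicator_def sum.If_cases Int_def)
  qed
  then have "measure_pmf.expectation ?M (\<lambda>G. real (num_isolated G)) =
      measure_pmf.expectation ?M (\<lambda>G. \<Sum>v\<in>{1..n}. indicator {G. v \<in> isolated_vertices G} G)"
    by (intro integral_cong_AE) (auto simp: AE_measure_pmf_iff)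
  also have "\<dots> = (\<Sum>v\<in>{1..n}. measure_pmf.prob ?M {G. v \<in> isolated_vertices G})"
    by (subst Bochner_Integration.integral_sum)
       (auto intro: integrable_measure_pmf_finite finite_set_pmf_erdos_renyi)
  also have "\<dots> = real n * (1 - p) ^ (n - 1)"
    using assms by (simp add: prob_isolated_erdos_renyi)
  finally show ?thesis .
qed

lemma expectation_num_isolated_tensor_product:
  assumes "0 \<le> p" and "p \<le> 1"
  shows "measure_pmf.expectation (pair_pmf (erdos_renyi n p) (erdos_renyi n p))
           (\<lambda>(G, H). real (num_isolated (tensor_product G H))) =
         2 * real n ^ 2 * (1 - p) ^ (n - 1) - (real n * (1 - p) ^ (n - 1)) ^ 2"
proof -
  let ?M = "erdos_renyi n p"
  let ?P = "pair_pmf ?M ?M"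
  let ?I = "\<lambda>G. real (num_isolated G)"
  have int: "integrable ?P f" for f :: "_ \<Rightarrow> real"
    by (rule integrable_measure_pmf_finite) (simp add: finite_set_pmf_erdos_renyi)
  have "(case x of (G, H) \<Rightarrow> real (num_isolated (tensor_product G H))) =
      real n * ?I (fst x) + real n * ?I (snd x) - ?I (fst x) * ?I (snd x)"
    if "x \<in> set_pmf ?P" for x
    using that
    by (auto simp: num_isolated_tensor_product simple_graph_erdos_renyi(2))
  then have "measure_pmf.expectation ?P (\<lambda>(G, H). real (num_isolated (tensor_product G H))) =
      measure_pmf.expectation ?P
        (\<lambda>x. real n * ?I (fst x) + real n * ?I (snd x) - ?I (fst x) * ?I (snd x))"
    by (intro integral_cong_AE) (auto simp: AE_measure_pmf_iff)
  \<comment> \<open>The first two terms depend on one factor each and need only the marginals; only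
    the last needs independence.\<close>
  also have "\<dots> = real n * measure_pmf.expectation ?P (\<lambda>x. ?I (fst x))
      + real n * measure_pmf.expectation ?P (\<lambda>x. ?I (snd x))
      - measure_pmf.expectation ?P (\<lambda>x. ?I (fst x) * ?I (snd x))"
    by (simp add: int)
  also have "\<dots> = 2 * real n ^ 2 * (1 - p) ^ (n - 1) - (real n * (1 - p) ^ (n - 1)) ^ 2"
    unfolding expectation_pair_pmf_mult[where f = ?I and g = ?I,
        OF finite_set_pmf_erdos_renyi finite_set_pmf_erdos_renyi]
      expectation_pair_pmf_fst[where f = ?I] expectation_pair_pmf_snd[where f = ?I]
      expectation_num_isolated_erdos_renyi[OF assms]
    by (simp add: power2_eq_square)
  finally show ?thesis .
qed

theorem theorem6p1:
  fixes p :: real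
  assumes "0 < p" and "p < 1"
  shows "(\<lambda>n. measure_pmf.expectation (pair_pmf (erdos_renyi n p) (erdos_renyi n p))
                 (\<lambda>(G, H). real (num_isolated (tensor_product G H)))
               / (2 * real n ^ 2 * (1 - p) ^ (n - 1)))
         \<longlonglongrightarrow> 1"
proof -
  \<comment> \<open>For \<open>n > 0\<close> and \<open>p < 1\<close> the denominator is nonzero. At
    \<open>n = 0\<close> the equation fails: the left side is 1/2, while division by zero makes the
    right side 0. Hence the limit is transferred through an eventual equality.\<close>
  have ratio: "1 - (1 - p) ^ (n - 1) / 2 =
      measure_pmf.expectation (pair_pmf (erdos_renyi n p) (erdos_renyi n p))
        (\<lambda>(G, H). real (num_isolated (tensor_product G H))) / (2 * real n ^ 2 * (1 - p) ^ (n - 1))"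
    if "n > 0" for n
    using assms that
    by (subst expectation_num_isolated_tensor_product) (auto simp: field_simps power2_eq_square)
  have "(\<lambda>n. (1 - p) ^ n) \<longlonglongrightarrow> 0"
    using assms by (intro LIMSEQ_power_zero) simp
  \<comment> \<open>Shifting the index by one removes the truncated subtraction, as
    \<open>Suc n - 1 = n\<close>.\<close>
  then have "(\<lambda>n. (1 - p) ^ (n - 1)) \<longlonglongrightarrow> 0"
    by (subst filterlim_sequentially_Suc[symmetric]) simp
  then have "(\<lambda>n. 1 - (1 - p) ^ (n - 1) / 2) \<longlonglongrightarrow> 1"
    by (auto intro!: tendsto_eq_intros)
  then show ?thesis
    by (rule Lim_transform_eventually)
       (use eventually_gt_at_top[of 0] in eventually_elim, rule ratio)
qed

end
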